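(* Let $d\in\mathbb{N}$, $0<\alpha<d\wedge2$ and $p\in(1,\infty)$. If $p\ne2$, then $$\kappa_{(d-\alpha)/p}>\frac{4(p-1)}{p^2}\,\kappa_{(d-\alpha)/2}.$$
   Context: $a\wedge b=\min\{a,b\}$. For $0<\beta<d-\alpha$, $$\kappa_\beta=\frac{2^\alpha\Gamma\big(\frac{\beta+\alpha}{2}\big)\Gamma\big(\frac{d-\beta}{2}\big)}{\Gamma\big(\frac{\beta}{2}\big)\Gamma\big(\frac{d-\beta-\alpha}{2}\big)}.$$ *)

theory Defs
  imports "HOL-Analysis.Gamma_Function"
begin

text \<open>Only meaningful for \<open>0 < \<beta> < d - \<alpha>\<close>, where all Gamma arguments are positive.\<close>

definition kappa :: "nat \<Rightarrow> real \<Rightarrow> real \<Rightarrow> real" where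
  "kappa d \<alpha> \<beta> =
     2 powr \<alpha> * Gamma ((\<beta> + \<alpha>) / 2) * Gamma ((real d - \<beta>) / 2)
       / (Gamma (\<beta> / 2) * Gamma ((real d - \<beta> - \<alpha>) / 2))"

end

theory Submission
  imports Defs
begin

text \<open>
  Put \<open>a = \<alpha> / 2\<close>, \<open>s = (d - \<alpha>) / 2\<close> and \<open>x = s / p\<close>, \<open>y = s - x\<close>. The four Gamma factors of
  \<open>\<kappa>\<close> at \<open>\<beta> = (d - \<alpha>) / p = 2 x\<close> then pair up as
  \[ \kappa_\beta = 2^\alpha \, \frac{\Gamma(x + a)}{\Gamma(x)} \, \frac{\Gamma(y + a)}{\Gamma(y)}, \]
  and \<open>p = 2\<close> corresponds to \<open>x = y = s / 2\<close>. Moreover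
  \<open>4 (p - 1) / p\<^sup>2 = x y / (s / 2)\<^sup>2\<close>, so the constant on the right of the inequality is exactly
  what is needed to turn each \<open>\<Gamma>(t)\<close> in a denominator into \<open>t \<Gamma>(t) = \<Gamma>(t + 1)\<close>.
  With \<open>R(t) = \<Gamma>(t + a) / \<Gamma>(t + 1)\<close> the claim therefore reads
  \[ R(x) \, R(y) > R\big(\tfrac{x + y}{2}\big)^2 \quad (x \neq y), \]
  which is strict midpoint convexity of \<open>ln R\<close>. This holds because \<open>a < 1\<close>: the derivative
  \<open>\<psi>(t + a) - \<psi>(t + 1)\<close> of \<open>ln R\<close> is strictly increasing, the trigamma function being strictly
  decreasing on the positive axis (lemmas \<open>Digamma_diff_strict_mono\<close> and
  \<open>Gamma_ratio_strict_midpoint_log_convex\<close>).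
\<close>

lemma strict_midpoint_convex_of_deriv_strict_mono:
  fixes f f' :: "real \<Rightarrow> real"
  assumes "x < y"
    and deriv: "\<And>t. x \<le> t \<Longrightarrow> t \<le> y \<Longrightarrow> (f has_real_derivative f' t) (at t)"
    and mono: "\<And>u v. x \<le> u \<Longrightarrow> u < v \<Longrightarrow> v \<le> y \<Longrightarrow> f' u < f' v"
  shows "2 * f ((x + y) / 2) < f x + f y"
proof -
  define m where "m = (x + y) / 2"
  have m: "x < m" "m < y" "y - m = m - x"
    using \<open>x < y\<close> by (simp_all add: m_def field_simps)
  obtain u where u: "x < u" "u < m" "f m - f x = (m - x) * f' u"
    using MVT2[OF m(1), of f f'] deriv m by force
  obtain v where v: "m < v" "v < y" "f y - f m = (y - m) * f' v"
    using MVT2[OF m(2), of f f'] deriv m by force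
  have "f' u < f' v"
    using u v by (intro mono) auto
  then have "(m - x) * f' u < (m - x) * f' v"
    using m by simp
  then have "f m - f x < f y - f m"
    using u(3) v(3) m(3) by simp
  then show ?thesis
    by (simp add: m_def)
qed

text \<open>
  The derivative in \<open>u\<close> of the difference below is \<open>\<psi>'(u + a) - \<psi>'(u + b)\<close>, which is positive
  because the trigamma function \<open>\<psi>'\<close> is strictly decreasing.
\<close>

lemma Digamma_diff_strict_mono:
  fixes a b u v :: real
  assumes "0 \<le> a" "a < b" "0 < u" "u < v"
  shows "Digamma (u + a) - Digamma (u + b) < Digamma (v + a) - Digamma (v + b)"
proof (rule DERIV_pos_imp_increasing[OF \<open>u < v\<close>])
  fix t assume "u \<le> t" "t \<le> v"
  then have t: "0 < t + a" "t + a < t + b"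
    using assms by auto
  then have "((\<lambda>t. Digamma (t + a) - Digamma (t + b)) has_real_derivative
      Polygamma 1 (t + a) - Polygamma 1 (t + b)) (at t)"
    by (auto intro!: derivative_eq_intros elim!: nonpos_Ints_cases)
  moreover have "Polygamma 1 (t + b) < Polygamma 1 (t + a)"
    using t by (intro Polygamma_real_strict_antimono) auto
  ultimately show "\<exists>D. ((\<lambda>t. Digamma (t + a) - Digamma (t + b)) has_real_derivative D) (at t)
      \<and> 0 < D"
    by (meson diff_gt_0_iff_gt)
qed

lemma Gamma_ratio_strict_midpoint_log_convex:
  fixes a b x y :: real
  assumes "0 \<le> a" "a < b" "0 < x" "0 < y" "x \<noteq> y"
  shows "(Gamma ((x + y) / 2 + a) / Gamma ((x + y) / 2 + b))\<^sup>2
    < Gamma (x + a) / Gamma (x + b) * (Gamma (y + a) / Gamma (y + b))"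
  using \<open>0 < x\<close> \<open>0 < y\<close> \<open>x \<noteq> y\<close>
proof (induction x y rule: linorder_wlog)
  case (le x y)
  define L :: "real \<Rightarrow> real" where "L t = ln_Gamma (t + a) - ln_Gamma (t + b)" for t
  have exp_L: "exp (L t) = Gamma (t + a) / Gamma (t + b)" if "0 < t" for t
    using that assms(1,2) by (simp add: L_def exp_diff Gamma_real_pos_exp)
  have "2 * L ((x + y) / 2) < L x + L y"
  proof (rule strict_midpoint_convex_of_deriv_strict_mono)
    show "x < y"
      using le by simp
    show "(L has_real_derivative Digamma (t + a) - Digamma (t + b)) (at t)" if "x \<le> t" for t
      unfolding L_def using that assms(1,2) le by (auto intro!: derivative_eq_intros)
    show "Digamma (u + a) - Digamma (u + b) < Digamma (v + a) - Digamma (v + b)"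
      if "x \<le> u" "u < v" for u v
      using that assms(1,2) le by (intro Digamma_diff_strict_mono) auto
  qed
  then have "exp (2 * L ((x + y) / 2)) < exp (L x) * exp (L y)"
    by (simp flip: exp_add)
  then show ?case
    using le by (simp add: exp_double exp_L)
next
  case (sym x y)
  then show ?case
    by (simp add: add.commute mult.commute)
qed

text \<open>
  The case \<open>b = 1\<close> of the previous lemma, rewritten with \<open>\<Gamma>(t + 1) = t \<Gamma>(t)\<close> so that the ratios
  occurring in \<open>\<kappa>\<close> appear.
\<close>

lemma Gamma_ratio_product_gt:
  fixes a x y :: real
  assumes "0 \<le> a" "a < 1" "0 < x" "0 < y" "x \<noteq> y"
  defines "m \<equiv> (x + y) / 2"
  shows "x * y / m\<^sup>2 * (Gamma (m + a) / Gamma m)\<^sup>2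
    < Gamma (x + a) / Gamma x * (Gamma (y + a) / Gamma y)"
proof -
  have shift: "Gamma (t + a) / Gamma t = t * (Gamma (t + a) / Gamma (t + 1))" if "0 < t" for t
    using that by (subst Gamma_plus1) (auto elim!: nonpos_Ints_cases)
  have "0 < m"
    using assms by (simp add: m_def)
  have "(Gamma (m + a) / Gamma (m + 1))\<^sup>2
      < Gamma (x + a) / Gamma (x + 1) * (Gamma (y + a) / Gamma (y + 1))"
    unfolding m_def using assms(1-5) by (intro Gamma_ratio_strict_midpoint_log_convex)
  then have "x * y * (Gamma (m + a) / Gamma (m + 1))\<^sup>2
      < x * y * (Gamma (x + a) / Gamma (x + 1) * (Gamma (y + a) / Gamma (y + 1)))"
    using \<open>0 < x\<close> \<open>0 < y\<close> by (intro mult_strict_left_mono) auto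
  also have "\<dots> = Gamma (x + a) / Gamma x * (Gamma (y + a) / Gamma y)"
    unfolding shift[OF \<open>0 < x\<close>] shift[OF \<open>0 < y\<close>] by (simp only: mult_ac)
  also have "x * y * (Gamma (m + a) / Gamma (m + 1))\<^sup>2
      = x * y / m\<^sup>2 * (Gamma (m + a) / Gamma m)\<^sup>2"
    unfolding shift[OF \<open>0 < m\<close>] power_mult_distrib using \<open>0 < m\<close> by simp
  finally show ?thesis .
qed

lemma kappa_eq_Gamma_ratios:
  "kappa d \<alpha> (2 * x) = 2 powr \<alpha> * (Gamma (x + \<alpha> / 2) / Gamma x
    * (Gamma (((real d - \<alpha>) / 2 - x) + \<alpha> / 2) / Gamma ((real d - \<alpha>) / 2 - x)))"
proof -
  have "(2 * x + \<alpha>) / 2 = x + \<alpha> / 2" "2 * x / 2 = x"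
    "(real d - 2 * x) / 2 = ((real d - \<alpha>) / 2 - x) + \<alpha> / 2"
    "(real d - 2 * x - \<alpha>) / 2 = (real d - \<alpha>) / 2 - x"
    by (simp_all add: field_simps)
  then show ?thesis
    by (simp only: kappa_def) simp
qed

theorem lemma8:
  fixes d :: nat and \<alpha> p :: real
  assumes "0 < \<alpha>" and "\<alpha> < min (real d) 2" and "1 < p" and "p \<noteq> 2"
  shows "kappa d \<alpha> ((real d - \<alpha>) / p) > 4 * (p - 1) / p\<^sup>2 * kappa d \<alpha> ((real d - \<alpha>) / 2)"
proof -
  define a s where "a = \<alpha> / 2" and "s = (real d - \<alpha>) / 2"
  define x y m where "x = s / p" and "y = s - x" and "m = (x + y) / 2"
  define K where "K t = Gamma (t + a) / Gamma t" for t :: real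
  have "0 < s" "0 < p"
    using assms by (auto simp: s_def)
  have "0 < x" "0 < y" "x \<noteq> y"
    using \<open>0 < s\<close> \<open>1 < p\<close> \<open>p \<noteq> 2\<close> by (auto simp: x_def y_def field_simps)
  have m: "m = s / 2" "s - m = m"
    by (simp_all add: m_def y_def)
  have beta: "(real d - \<alpha>) / p = 2 * x" "(real d - \<alpha>) / 2 = 2 * m"
    using \<open>0 < p\<close> by (simp_all add: x_def s_def m(1) field_simps)
  have kappa_p: "kappa d \<alpha> ((real d - \<alpha>) / p) = 2 powr \<alpha> * (K x * K y)"
    unfolding beta(1) kappa_eq_Gamma_ratios K_def y_def s_def a_def ..
  have kappa_2: "kappa d \<alpha> ((real d - \<alpha>) / 2) = 2 powr \<alpha> * (K m)\<^sup>2"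
    using kappa_eq_Gamma_ratios[of d \<alpha> m, folded a_def s_def, unfolded m(2)]
    by (simp only: beta(2) K_def power2_eq_square)
  have const: "4 * (p - 1) / p\<^sup>2 = x * y / m\<^sup>2"
    using \<open>0 < s\<close> \<open>0 < p\<close> unfolding m(1) y_def x_def
    by (simp add: field_simps power2_eq_square)
  have "x * y / m\<^sup>2 * (K m)\<^sup>2 < K x * K y"
    unfolding K_def m_def using assms \<open>0 < x\<close> \<open>0 < y\<close> \<open>x \<noteq> y\<close>
    by (intro Gamma_ratio_product_gt) (auto simp: a_def)
  then have "2 powr \<alpha> * (x * y / m\<^sup>2 * (K m)\<^sup>2) < 2 powr \<alpha> * (K x * K y)"
    by (intro mult_strict_left_mono) simp_all
  then show ?thesis
    unfolding kappa_p kappa_2 const by (simp only: mult_ac)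
qed

end
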